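(* Let $R\subseteq\mathbb{R}$ be a ring, let $I$ be an interval with $\inf I=0$, let $\mathscr{M}$ be an $R$-weighted mean on $I$, and let $\lambda=(\lambda_n)_{n=1}^\infty\in W^0(R)$. Define $$\mathscr{C}_\lambda(\mathscr{M}):=\sup_{y>0}\ \liminf_{n\to\infty}\ \frac{\lambda_1+\cdots+\lambda_n}{y}\cdot\mathscr{M}\Big(\Big(\tfrac{y}{\lambda_1},\tfrac{y}{\lambda_1+\lambda_2},\dots,\tfrac{y}{\lambda_1+\cdots+\lambda_n}\Big),(\lambda_1,\dots,\lambda_n)\Big).$$ Then: (i) If $\sum_{n=1}^\infty\lambda_n=\infty$, then $\mathscr{H}_\lambda(\mathscr{M})\ge\mathscr{C}_\lambda(\mathscr{M})$. (ii) If $\mathscr{M}$ is monotone and satisfies the $\lambda$-Kedlaya inequality, then $\mathscr{H}_\lambda(\mathscr{M})\le\mathscr{C}_\lambda(\mathscr{M})$.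
   Context: For an interval $I\subseteq\mathbb{R}$ and a ring $R\subseteq\mathbb{R}$, let $W_n(R)=\{(\lambda_1,\dots,\lambda_n)\in R^n:\lambda_1,\dots,\lambda_n\ge0,\ \lambda_1+\cdots+\lambda_n>0\}$. An $R$-weighted mean on $I$ is a function $\mathscr{M}:\bigcup_{n\ge1}I^n\times W_n(R)\to I$ such that for all $n$: (1) nullhomogeneity in the weights: $\mathscr{M}(x,\lambda)=\mathscr{M}(x,t\lambda)$ for all $x\in I^n$, $\lambda\in W_n(R)$ and $t\in R$, $t>0$; (2) reduction principle: $\mathscr{M}(x,\lambda+\mu)=\mathscr{M}(x\odot x,\lambda\odot\mu)$ for all $x\in I^n$, $\lambda,\mu\in W_n(R)$, where $(p_1,\dots,p_n)\odot(q_1,\dots,q_n):=(p_1,q_1,\dots,p_n,q_n)$; (3) mean value property: $\min_i x_i\le\mathscr{M}(x,\lambda)\le\max_i x_i$ for all $x\in I^n$, $\lambda\in W_n(R)$; (4) elimination principle: if $\lambda_j=0$, then $\mathscr{M}(x,\lambda)$ is unchanged when the $j$-th entry of both $x$ and $\lambda$ is deleted. $\mathscr{M}$ is monotone if $\mathscr{M}(x,\lambda)$ is nondecreasing in each variable $x_i$ (for all $n$, $\lambda\in W_n(R)$). $W^0(R)$ denotes the set of sequences $\lambda=(\lambda_n)_{n=1}^\infty$ in $R$ with $\lambda_1>0$ and $\lambda_n\ge0$ for all $n\geq 2$. For $\lambda\in W^0(R)$, the $\lambda$-Hardy constant $\mathscr{H}_\lambda(\mathscr{M})$ is the smallest extended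 real number $C$ such that $\sum_{n=1}^\infty\lambda_n\,\mathscr{M}((x_1,\dots,x_n),(\lambda_1,\dots,\lambda_n))\le C\sum_{n=1}^\infty\lambda_nx_n$ for all sequences $(x_n)$ in $I$. $\mathscr{M}$ satisfies the $\lambda$-Kedlaya inequality if for all $n\in\mathbb{N}$ and $x\in I^n$, with $\Lambda_k=\lambda_1+\cdots+\lambda_k$, $a_k=\frac1{\Lambda_k}\sum_{i=1}^k\lambda_ix_i$ and $m_k=\mathscr{M}((x_1,\dots,x_k),(\lambda_1,\dots,\lambda_k))$, one has $$\frac1{\Lambda_n}\sum_{k=1}^n\lambda_km_k\le\mathscr{M}\big((a_1,\dots,a_n),(\lambda_1,\dots,\lambda_n)\big).$$
   Formalization: Part (ii) is proved for I unbounded above: for bounded I the supremum over all y>0 is undefined, and (ii) can fail if it runs only over y with every y/(λ_1+…+λ_k) in I. Part (i) is proved for every I, with the supremum over those y. *)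

theory Defs
  imports "HOL-Analysis.Analysis"
begin

text \<open>
  Vectors of length \<open>n\<close> are lists of length \<open>n\<close>. Infinite sequences are functions on
  \<open>nat\<close> indexed from 0, so that \<open>w 0\<close> is the first term \<open>\<lambda>\<^sub>1\<close>.
\<close>

text \<open>A unit element is not required, so rings with and without \<open>1\<close> are both covered.\<close>

definition real_ring :: "real set \<Rightarrow> bool" where
  "real_ring R \<longleftrightarrow> 0 \<in> R \<and> (\<forall>a\<in>R. \<forall>b\<in>R. a - b \<in> R \<and> a * b \<in> R)"

definition vecs :: "real set \<Rightarrow> nat \<Rightarrow> real list set" where
  "vecs I n = {x. length x = n \<and> set x \<subseteq> I}"

definition weights :: "real set \<Rightarrow> nat \<Rightarrow> real list set" where
  "weights R n = {l \<in> vecs R n. (\<forall>a\<in>set l. 0 \<le> a) \<and> 0 < sum_list l}"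

definition delete_nth :: "nat \<Rightarrow> 'a list \<Rightarrow> 'a list" where
  "delete_nth j xs = take j xs @ drop (Suc j) xs"

text \<open>
  \<open>M x l\<close> is constrained only for \<open>x \<in> vecs I n\<close> and \<open>l \<in> weights R n\<close>.
  For lists of equal length, \<^const>\<open>splice\<close> is the shuffle
  \<open>(p\<^sub>1, q\<^sub>1, \<dots>, p\<^sub>n, q\<^sub>n)\<close> of the reduction principle.
\<close>

definition weighted_mean :: "real set \<Rightarrow> real set \<Rightarrow> (real list \<Rightarrow> real list \<Rightarrow> real) \<Rightarrow> bool" where
  "weighted_mean R I M \<longleftrightarrow>
    (\<forall>n\<ge>1. \<forall>x\<in>vecs I n. \<forall>l\<in>weights R n. M x l \<in> I) \<and>
    (\<forall>n\<ge>1. \<forall>x\<in>vecs I n. \<forall>l\<in>weights R n. \<forall>t\<in>R. 0 < t \<longrightarrow> M x l = M x (map ((*) t) l)) \<and>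
    (\<forall>n\<ge>1. \<forall>x\<in>vecs I n. \<forall>l\<in>weights R n. \<forall>m\<in>weights R n.
      M x (map2 (+) l m) = M (splice x x) (splice l m)) \<and>
    (\<forall>n\<ge>1. \<forall>x\<in>vecs I n. \<forall>l\<in>weights R n. Min (set x) \<le> M x l \<and> M x l \<le> Max (set x)) \<and>
    (\<forall>n\<ge>1. \<forall>x\<in>vecs I n. \<forall>l\<in>weights R n. \<forall>j<n. l ! j = 0 \<longrightarrow>
      M x l = M (delete_nth j x) (delete_nth j l))"

definition monotone_mean :: "real set \<Rightarrow> real set \<Rightarrow> (real list \<Rightarrow> real list \<Rightarrow> real) \<Rightarrow> bool" where
  "monotone_mean R I M \<longleftrightarrow>
    (\<forall>n\<ge>1. \<forall>x\<in>vecs I n. \<forall>l\<in>weights R n. \<forall>i<n. \<forall>t\<in>I.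
      x ! i \<le> t \<longrightarrow> M x l \<le> M (x[i := t]) l)"

definition weight_seqs :: "real set \<Rightarrow> (nat \<Rightarrow> real) set" where
  "weight_seqs R = {w. range w \<subseteq> R \<and> 0 < w 0 \<and> (\<forall>n. 0 \<le> w n)}"

definition initial :: "nat \<Rightarrow> (nat \<Rightarrow> real) \<Rightarrow> real list" where
  "initial n f = map f [0..<n]"

definition psum :: "(nat \<Rightarrow> real) \<Rightarrow> nat \<Rightarrow> real" where
  "psum w n = (\<Sum>i<n. w i)"

definition hardy_constant ::
  "real set \<Rightarrow> (real list \<Rightarrow> real list \<Rightarrow> real) \<Rightarrow> (nat \<Rightarrow> real) \<Rightarrow> ereal" where
  "hardy_constant I M w = Inf {C :: ereal. \<forall>x. range x \<subseteq> I \<longrightarrow>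
    (\<Sum>n. ereal (w n * M (initial (Suc n) x) (initial (Suc n) w))) \<le> C * (\<Sum>n. ereal (w n * x n))}"

definition kedlaya_inequality ::
  "real set \<Rightarrow> (real list \<Rightarrow> real list \<Rightarrow> real) \<Rightarrow> (nat \<Rightarrow> real) \<Rightarrow> bool" where
  "kedlaya_inequality I M w \<longleftrightarrow>
    (\<forall>n\<ge>1. \<forall>x. (\<forall>i<n. x i \<in> I) \<longrightarrow>
      1 / psum w n * (\<Sum>k<n. w k * M (initial (Suc k) x) (initial (Suc k) w))
        \<le> M (initial n (\<lambda>k. 1 / psum w (Suc k) * (\<Sum>i<Suc k. w i * x i))) (initial n w))"

text \<open>
  For a bounded interval the points \<open>y / (w 0 + \<dots> + w k)\<close> need not lie in \<open>I\<close>, and \<open>M\<close> is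
  not defined there. The supremum is taken over the \<open>y > 0\<close> for which they all do; when
  \<open>I\<close> is unbounded above and \<open>Inf I = 0\<close>, this is every \<open>y > 0\<close>.
\<close>

definition C_constant ::
  "real set \<Rightarrow> (real list \<Rightarrow> real list \<Rightarrow> real) \<Rightarrow> (nat \<Rightarrow> real) \<Rightarrow> ereal" where
  "C_constant I M w = (SUP y\<in>{y. 0 < y \<and> (\<forall>k. y / psum w (Suc k) \<in> I)}.
    liminf (\<lambda>n. ereal (psum w n / y * M (initial n (\<lambda>k. y / psum w (Suc k))) (initial n w))))"

end

theory Submission
  imports Defs
begin

text \<open>
  Lower bound: test the Hardy inequality on the sequence that equals \<open>y / \<Lambda>\<^sub>k\<close> up to an
  index \<open>N\<close> and is negligibly small afterwards, so that the right-hand side stays finite. By the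
  Abel--Dini theorem \<open>\<Sum> \<lambda>\<^sub>k / \<Lambda>\<^sub>k\<close> diverges with \<open>\<Sum> \<lambda>\<^sub>k\<close>, hence the first \<open>N\<close> terms
  dominate both sides as \<open>N \<rightarrow> \<infinity>\<close>.

  Upper bound: if \<open>y = \<Sum> \<lambda>\<^sub>k x\<^sub>k\<close> is finite and positive, the weighted averages of \<open>x\<close> are at most
  \<open>y / \<Lambda>\<^sub>k\<close>, so the Kedlaya inequality and monotonicity bound \<open>\<Sum>\<^sub>k\<^sub>\<le>\<^sub>n \<lambda>\<^sub>k m\<^sub>k\<close> by
  \<open>\<Lambda>\<^sub>n\<close> times the mean of the \<open>y / \<Lambda>\<^sub>k\<close>.
\<close>

section \<open>Initial segments and partial sums of weight sequences\<close>

lemma length_initial [simp]: "length (initial n f) = n"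
  by (simp add: initial_def)

lemma nth_initial [simp]: "i < n \<Longrightarrow> initial n f ! i = f i"
  by (simp add: initial_def)

lemma set_initial: "set (initial n f) = f ` {..<n}"
  by (auto simp: initial_def)

lemma initial_cong: "(\<And>i. i < n \<Longrightarrow> f i = g i) \<Longrightarrow> initial n f = initial n g"
  by (simp add: initial_def)

lemma sum_list_initial: "sum_list (initial n f) = psum f n"
  by (simp add: initial_def psum_def sum_list_sum_nth atLeast0LessThan)

lemma initial_in_vecs: "(\<And>i. i < n \<Longrightarrow> f i \<in> I) \<Longrightarrow> initial n f \<in> vecs I n"
  by (auto simp: vecs_def set_initial)

lemma weight_seqs_nonneg: "w \<in> weight_seqs R \<Longrightarrow> 0 \<le> w n"
  by (simp add: weight_seqs_def)

lemma psum_mono: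
  assumes "w \<in> weight_seqs R" "m \<le> n"
  shows "psum w m \<le> psum w n"
  unfolding psum_def using assms
  by (intro sum_mono2) (auto simp: weight_seqs_def)

lemma psum_pos:
  assumes "w \<in> weight_seqs R" "0 < n"
  shows "0 < psum w n"
proof -
  have "psum w 1 \<le> psum w n"
    using assms by (intro psum_mono) auto
  thus ?thesis
    using assms by (auto simp: psum_def weight_seqs_def)
qed

lemma initial_in_weights:
  assumes "w \<in> weight_seqs R" "0 < n"
  shows "initial n w \<in> weights R n"
  using assms psum_pos[OF assms]
  by (auto simp: weights_def sum_list_initial set_initial weight_seqs_def intro!: initial_in_vecs)

section \<open>Intervals with infimum 0\<close>

lemma interval_Inf_zero_nonneg:
  assumes "(INF x\<in>I. ereal x) = 0" "x \<in> I"
  shows "0 \<le> x"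
  using INF_lower[of x I ereal] assms by simp

text \<open>The infimum 0 may or may not be attained, so \<open>e\<close> is caught between
  \<open>b\<close> and a point of \<open>I\<close> strictly below \<open>e\<close>.\<close>

lemma interval_Inf_zero_mem:
  assumes "is_interval I" "(INF x\<in>I. ereal x) = 0" "b \<in> I" "0 < e" "e \<le> b"
  shows "e \<in> I"
proof -
  have "(INF x\<in>I. ereal x) < ereal e"
    using assms by simp
  then obtain a where "a \<in> I" "a < e"
    by (auto simp: INF_less_iff)
  thus ?thesis
    using assms(1,3,5) unfolding is_interval_1 by (meson less_imp_le)
qed

lemma unbounded_interval_Inf_zero_mem:
  assumes "is_interval I" "(INF x\<in>I. ereal x) = 0" "\<not> bdd_above I" "0 < a"
  shows "a \<in> I"
proof -
  obtain b where "b \<in> I" "a < b"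
    using assms(3) by (auto simp: bdd_above_def not_le)
  thus ?thesis
    using interval_Inf_zero_mem[OF assms(1,2) _ assms(4)] by simp
qed

section \<open>Weighted means of initial segments\<close>

lemma weighted_mean_mem:
  assumes "weighted_mean R I M" "w \<in> weight_seqs R" "0 < n" "\<And>i. i < n \<Longrightarrow> x i \<in> I"
  shows "M (initial n x) (initial n w) \<in> I"
  using assms initial_in_weights[OF assms(2,3)] initial_in_vecs[of n x I]
  by (auto simp: weighted_mean_def Suc_le_eq)

lemma weighted_mean_le_Max:
  assumes "weighted_mean R I M" "w \<in> weight_seqs R" "0 < n" "\<And>i. i < n \<Longrightarrow> x i \<in> I"
  shows "M (initial n x) (initial n w) \<le> Max (set (initial n x))"
  using assms initial_in_weights[OF assms(2,3)] initial_in_vecs[of n x I]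
  by (auto simp: weighted_mean_def Suc_le_eq)

lemma weighted_mean_ge_Min:
  assumes "weighted_mean R I M" "w \<in> weight_seqs R" "0 < n" "\<And>i. i < n \<Longrightarrow> x i \<in> I"
  shows "Min (set (initial n x)) \<le> M (initial n x) (initial n w)"
  using assms initial_in_weights[OF assms(2,3)] initial_in_vecs[of n x I]
  by (auto simp: weighted_mean_def Suc_le_eq)

lemma monotone_mean_le:
  assumes "monotone_mean R I M" "w \<in> weight_seqs R" "0 < n"
    and x: "\<And>i. i < n \<Longrightarrow> x i \<in> I" and y: "\<And>i. i < n \<Longrightarrow> y i \<in> I"
    and le: "\<And>i. i < n \<Longrightarrow> x i \<le> y i"
  shows "M (initial n x) (initial n w) \<le> M (initial n y) (initial n w)"
proof -
  \<comment> \<open>Consecutive vectors \<open>z k\<close> and \<open>z (Suc k)\<close> differ in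
    one coordinate only, which is the situation covered by \<open>monotone_mean\<close>.\<close>
  define z where "z k = initial n (\<lambda>i. if i < k then y i else x i)" for k
  have "M (initial n x) (initial n w) \<le> M (z k) (initial n w)" if "k \<le> n" for k
    using that
  proof (induction k)
    case 0
    show ?case by (simp add: z_def)
  next
    case (Suc k)
    have "z (Suc k) = (z k)[k := y k]"
      using Suc.prems by (intro nth_equalityI) (auto simp: z_def nth_list_update)
    moreover have "z k \<in> vecs I n"
      unfolding z_def using x y by (intro initial_in_vecs) auto
    moreover have "z k ! k \<le> y k"
      using Suc.prems le by (simp add: z_def)
    ultimately have "M (z k) (initial n w) \<le> M (z (Suc k)) (initial n w)"
      using assms(1,3) initial_in_weights[OF assms(2,3)] y Suc.prems
      unfolding monotone_mean_def by (metis Suc_le_eq One_nat_def)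
    thus ?case
      using Suc by simp
  qed
  moreover have "z n = initial n y"
    unfolding z_def by (intro initial_cong) auto
  ultimately show ?thesis
    by (metis order_refl)
qed

section \<open>Lower bound: Abel-Dini divergence and truncated test sequences\<close>

lemma Abel_Dini:
  assumes w: "w \<in> weight_seqs R" and div: "(\<Sum>n. ereal (w n)) = \<infinity>"
  shows "\<not> summable (\<lambda>n. w n / psum w (Suc n))"
proof
  assume "summable (\<lambda>n. w n / psum w (Suc n))"
  then obtain m where m: "\<And>k n. k \<ge> m \<Longrightarrow> norm (\<Sum>i=k..<n. w i / psum w (Suc i)) < 1/2"
    unfolding summable_Cauchy by (metis half_gt_zero zero_less_one)
  \<comment> \<open>Once the partial sum of weights has more than doubled beyond \<open>m\<close>,
    the block from \<open>m\<close> to \<open>n\<close> contributes at least 1/2, contradicting the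
    Cauchy bound.\<close>
  have "\<exists>n. 2 * psum w m < psum w n"
  proof (rule ccontr)
    assume "\<not> ?thesis"
    hence "(\<Sum>n. ereal (w n)) \<le> ereal (2 * psum w m)"
      using weight_seqs_nonneg[OF w] 
      by (intro suminf_bound) (auto simp: psum_def not_less)
    with div show False by simp
  qed
  then obtain n where n: "2 * psum w m < psum w n" ..
  have "0 \<le> psum w m"
    unfolding psum_def using weight_seqs_nonneg[OF w] by (intro sum_nonneg) auto
  have "m \<le> n"
  proof (rule ccontr)
    assume "\<not> m \<le> n"
    hence "psum w n \<le> psum w m" by (intro psum_mono[OF w]) auto
    with n \<open>0 \<le> psum w m\<close> show False by simp
  qed
  have pos: "0 < psum w n"
    using n \<open>0 \<le> psum w m\<close> by simp
  \<comment> \<open>Enlarging every denominator to \<open>psum w n\<close> only decreases the block,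
    and its numerators then add up to \<open>psum w n - psum w m\<close>.\<close>
  have "1/2 \<le> (psum w n - psum w m) / psum w n"
    using n pos by (simp add: field_simps)
  also have "\<dots> = (\<Sum>i=m..<n. w i / psum w n)"
    using \<open>m \<le> n\<close> unfolding psum_def
    by (simp add: sum_divide_distrib[symmetric] sum_diff_nat_ivl[of 0 m n, symmetric] lessThan_atLeast0)
  also have "\<dots> \<le> (\<Sum>i=m..<n. w i / psum w (Suc i))"
    by (intro sum_mono divide_left_mono psum_mono[OF w] weight_seqs_nonneg[OF w])
       (auto intro!: mult_pos_pos pos psum_pos[OF w])
  also have "\<dots> < 1/2"
    using m[of m n] by simp
  finally show False by simp
qed

lemma not_summable_partial_sums_unbounded:
  fixes f :: "nat \<Rightarrow> real"
  assumes "\<And>n. 0 \<le> f n" "\<not> summable f"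
  shows "\<exists>N\<ge>m. B < (\<Sum>n<N. f n)"
proof -
  obtain N where N: "B < (\<Sum>n<N. f n)"
    using assms summableI_nonneg_bounded[of f B] by (meson not_le)
  have "(\<Sum>n<N. f n) \<le> (\<Sum>n<max m N. f n)"
    using assms by (intro sum_mono2) auto
  with N show ?thesis
    by (intro exI[of _ "max m N"]) auto
qed

text \<open>Admissibility of a single constant, split off from the infimum so that one candidate can
  be tested or exhibited at a time.\<close>

definition hardy_bound ::
  "real set \<Rightarrow> (real list \<Rightarrow> real list \<Rightarrow> real) \<Rightarrow> (nat \<Rightarrow> real) \<Rightarrow> ereal \<Rightarrow> bool" where
  "hardy_bound I M w C \<longleftrightarrow> (\<forall>x. range x \<subseteq> I \<longrightarrow>
    (\<Sum>n. ereal (w n * M (initial (Suc n) x) (initial (Suc n) w))) \<le> C * (\<Sum>n. ereal (w n * x n)))"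

lemma hardy_constant_eq: "hardy_constant I M w = Inf {C. hardy_bound I M w C}"
  by (simp add: hardy_constant_def hardy_bound_def)

text \<open>The test sequence follows \<open>y / psum w (Suc n)\<close> below \<open>N\<close>. Its
  terms from \<open>n0\<close> on produce the left-hand side; the summand 2 on the right absorbs the
  small tail, being the sum of the powers of 1/2.\<close>

lemma hardy_bound_truncated:
  assumes I: "is_interval I" "(INF x\<in>I. ereal x) = 0"
    and M: "weighted_mean R I M" and w: "w \<in> weight_seqs R"
    and C: "hardy_bound I M w (ereal C)"
    and y: "0 < y" "\<And>k. y / psum w (Suc k) \<in> I"
    and n0: "n0 \<le> N" "\<And>n. n \<ge> n0 \<Longrightarrow>
      c \<le> psum w n / y * M (initial n (\<lambda>k. y / psum w (Suc k))) (initial n w)"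
  shows "c * y * (\<Sum>n=n0..<N. w n / psum w (Suc n)) \<le> C * (y * (\<Sum>n<N. w n / psum w (Suc n)) + 2)"
proof -
  note w0 = weight_seqs_nonneg[OF w]
  \<comment> \<open>The cap \<open>b\<close> keeps the tail inside \<open>I\<close>. The other bound
    makes \<open>w n * e n\<close> at most \<open>(1/2)^n\<close>, where the 1 in the denominator
    takes care of vanishing weights.\<close>
  define b where "b = y / psum w (Suc 0)"
  define e where "e n = min b ((1/2)^n / (1 + w n))" for n
  define x where "x n = (if n < N then y / psum w (Suc n) else e n)" for n
  define m where "m n = M (initial (Suc n) x) (initial (Suc n) w)" for n
  have "0 < b" "b \<in> I"
    unfolding b_def using y psum_pos[OF w] by auto
  have e_pos: "0 < e n" for n
    using \<open>0 < b\<close> w0[of n] by (auto simp: e_def intro!: divide_pos_pos add_pos_nonneg)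
  have e_I: "e n \<in> I" for n
    using I \<open>b \<in> I\<close> e_pos[of n] by (rule interval_Inf_zero_mem) (simp add: e_def)
  have x_I: "x n \<in> I" for n
    using y(2) e_I by (simp add: x_def)
  have x_pos: "0 < x n" for n
    using e_pos y(1) psum_pos[OF w] by (simp add: x_def)
  have m_nonneg: "0 \<le> m n" for n
    unfolding m_def
    by (intro interval_Inf_zero_nonneg[OF I(2)] weighted_mean_mem[OF M w] x_I) auto
  have we: "w n * e n \<le> (1/2)^n" for n
  proof -
    have "w n * e n \<le> (1 + w n) * ((1/2)^n / (1 + w n))"
      unfolding e_def using w0[of n] \<open>0 < b\<close> by (intro mult_mono) auto
    also have "\<dots> = (1/2)^n"
      using w0[of n] by simp
    finally show ?thesis .
  qed
  define T where "T = (\<Sum>n<N. w n / psum w (Suc n))"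
  define s where "s = (\<Sum>n. ereal (w n * x n))"
  have "s \<le> ereal (y * T + 2)"
    unfolding s_def
  proof (rule suminf_bound[OF allI])
    fix K
    have "(\<Sum>n<K. w n * x n) \<le>
      (\<Sum>n<K. (if n < N then y * (w n / psum w (Suc n)) else 0) + (1/2)^n)"
      using we by (intro sum_mono) (auto simp: x_def mult.commute)
    also have "\<dots> = (\<Sum>n\<in>{..<K} \<inter> {..<N}. y * (w n / psum w (Suc n))) + (\<Sum>n<K. (1/2)^n)"
      by (simp add: sum.distrib sum.If_cases lessThan_def)
    also have "(\<Sum>n\<in>{..<K} \<inter> {..<N}. y * (w n / psum w (Suc n))) \<le> y * T"
      unfolding T_def sum_distrib_left using w0 y(1) psum_pos[OF w]
      by (intro sum_mono2) (auto intro!: mult_nonneg_nonneg divide_nonneg_pos)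
    also have "(\<Sum>n<K. (1/2)^n) \<le> (2 :: real)"
      by (simp add: sum_gp_strict)
    finally show "(\<Sum>n<K. ereal (w n * x n)) \<le> ereal (y * T + 2)"
      by simp
  next
    show "0 \<le> ereal (w n * x n)" for n
      using w0[of n] x_pos[of n] by simp
  qed
  moreover have "ereal (w 0 * x 0) \<le> s"
    unfolding s_def using w0 x_pos
    by (intro order.trans[OF _ suminf_upper[of _ 1]]) (auto simp: less_imp_le)
  moreover have "0 < w 0 * x 0"
    using w x_pos by (simp add: weight_seqs_def)
  ultimately obtain s' where s': "s = ereal s'" "0 < s'" "s' \<le> y * T + 2"
    by (cases s) auto
  have "range x \<subseteq> I"
    using x_I by auto
  hence "(\<Sum>n. ereal (w n * m n)) \<le> ereal C * s"
    using C unfolding hardy_bound_def m_def s_def by blast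
  hence bound: "(\<Sum>n. ereal (w n * m n)) \<le> ereal (C * s')"
    by (simp add: s'(1))
  have partial: "(\<Sum>n<K. w n * m n) \<le> C * s'" for K
  proof -
    have "(\<Sum>n<K. ereal (w n * m n)) \<le> (\<Sum>n. ereal (w n * m n))"
      using w0 m_nonneg by (intro suminf_upper) auto
    with bound have "(\<Sum>n<K. ereal (w n * m n)) \<le> ereal (C * s')"
      by (rule order.trans[rotated])
    thus ?thesis by simp
  qed
  \<comment> \<open>The empty partial sum gives \<open>0 \<le> C * s'\<close> with \<open>s'\<close>
    positive. The sign of \<open>C\<close> is what later allows \<open>s'\<close> to be replaced by
    its upper bound.\<close>
  have "0 \<le> C"
    using partial[of 0] s'(2) by (simp add: zero_le_mult_iff)
  have "c * y * (\<Sum>n=n0..<N. w n / psum w (Suc n)) \<le> (\<Sum>n=n0..<N. w n * m n)"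
    unfolding sum_distrib_left
  proof (rule sum_mono)
    fix n assume n: "n \<in> {n0..<N}"
    have pos: "0 < psum w (Suc n)"
      by (rule psum_pos[OF w]) simp
    \<comment> \<open>The term with index \<open>n\<close> involves a vector of length
      \<open>Suc n\<close>, which for \<open>n < N\<close> does not yet see the tail of
      \<open>x\<close>.\<close>
    have "initial (Suc n) (\<lambda>k. y / psum w (Suc k)) = initial (Suc n) x"
      using n by (intro initial_cong) (auto simp: x_def)
    hence "c \<le> psum w (Suc n) / y * m n"
      using n0(2)[of "Suc n"] n by (simp add: m_def)
    hence "c * y / psum w (Suc n) \<le> m n"
      using pos y(1) by (simp add: field_simps)
    hence "w n * (c * y / psum w (Suc n)) \<le> w n * m n"
      by (intro mult_left_mono w0)
    thus "c * y * (w n / psum w (Suc n)) \<le> w n * m n"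
      by (simp add: field_simps)
  qed
  also have "\<dots> \<le> (\<Sum>n<N. w n * m n)"
    using w0 m_nonneg by (intro sum_mono2) auto
  also have "\<dots> \<le> C * s'"
    by (rule partial)
  also have "\<dots> \<le> C * (y * T + 2)"
    using s'(3) \<open>0 \<le> C\<close> by (intro mult_left_mono)
  finally show "c * y * (\<Sum>n=n0..<N. w n / psum w (Suc n))
      \<le> C * (y * (\<Sum>n<N. w n / psum w (Suc n)) + 2)"
    by (simp add: T_def)
qed

text \<open>If \<open>c\<close> exceeded \<open>C\<close>, the truncated inequality would bound the
  partial sums of \<open>w n / psum w (Suc n)\<close> uniformly in \<open>N\<close>, against
  \<open>Abel_Dini\<close>.\<close>

lemma hardy_bound_ge:
  assumes I: "is_interval I" "(INF x\<in>I. ereal x) = 0"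
    and M: "weighted_mean R I M" and w: "w \<in> weight_seqs R"
    and div: "(\<Sum>n. ereal (w n)) = \<infinity>"
    and C: "hardy_bound I M w (ereal C)"
    and y: "0 < y" "\<And>k. y / psum w (Suc k) \<in> I"
    and n0: "\<And>n. n \<ge> n0 \<Longrightarrow>
      c \<le> psum w n / y * M (initial n (\<lambda>k. y / psum w (Suc k))) (initial n w)"
  shows "c \<le> C"
proof (rule ccontr)
  assume "\<not> c \<le> C"
  hence less: "0 < (c - C) * y"
    using y(1) by simp
  define f where "f n = w n / psum w (Suc n)" for n
  have f_nonneg: "0 \<le> f n" for n
    unfolding f_def
    by (intro divide_nonneg_pos weight_seqs_nonneg[OF w] psum_pos[OF w]) auto
  have "\<not> summable f"
    using Abel_Dini[OF w div] by (simp add: f_def[abs_def])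
  \<comment> \<open>The threshold comes from solving the inequality of
    \<open>hardy_bound_truncated\<close> for the sum up to \<open>N\<close>.\<close>
  then obtain N where N: "n0 \<le> N" "(2 * C + c * y * (\<Sum>n<n0. f n)) / ((c - C) * y) < (\<Sum>n<N. f n)"
    using not_summable_partial_sums_unbounded[of f, OF f_nonneg] by blast
  have "(\<Sum>n=n0..<N. f n) = (\<Sum>n<N. f n) - (\<Sum>n<n0. f n)"
    using N(1) by (simp add: sum_diff_nat_ivl[of 0 n0 N, symmetric] lessThan_atLeast0)
  with hardy_bound_truncated[OF I M w C y N(1) n0]
  have "c * y * ((\<Sum>n<N. f n) - (\<Sum>n<n0. f n)) \<le> C * (y * (\<Sum>n<N. f n) + 2)"
    by (simp add: f_def)
  hence "(c - C) * y * (\<Sum>n<N. f n) \<le> 2 * C + c * y * (\<Sum>n<n0. f n)"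
    by (simp add: algebra_simps)
  with N(2) less show False
    by (simp add: field_simps)
qed

text \<open>This serves to pass from an extended real constant to a larger real one. Order survives
  the multiplication because the series on the right is nonnegative.\<close>

lemma hardy_bound_mono:
  assumes "hardy_bound I M w C" "C \<le> D" "\<And>n. 0 \<le> w n" "\<And>x. x \<in> I \<Longrightarrow> 0 \<le> x"
  shows "hardy_bound I M w D"
  unfolding hardy_bound_def
proof (intro allI impI)
  fix x :: "nat \<Rightarrow> real" assume x: "range x \<subseteq> I"
  have "(\<Sum>n. ereal (w n * M (initial (Suc n) x) (initial (Suc n) w))) \<le> C * (\<Sum>n. ereal (w n * x n))"
    using assms(1) x by (simp add: hardy_bound_def)
  also have "\<dots> \<le> D * (\<Sum>n. ereal (w n * x n))"
    using assms(2-4) x by (intro ereal_mult_right_mono suminf_0_le) (auto simp: range_subsetD)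
  finally show "(\<Sum>n. ereal (w n * M (initial (Suc n) x) (initial (Suc n) w)))
      \<le> D * (\<Sum>n. ereal (w n * x n))" .
qed

lemma C_constant_le_hardy_constant:
  assumes I: "is_interval I" "(INF x\<in>I. ereal x) = 0"
    and M: "weighted_mean R I M" and w: "w \<in> weight_seqs R"
    and div: "(\<Sum>n. ereal (w n)) = \<infinity>"
  shows "C_constant I M w \<le> hardy_constant I M w"
  unfolding hardy_constant_eq C_constant_def
proof (intro Inf_greatest SUP_least)
  fix C y
  assume "C \<in> {C. hardy_bound I M w C}" and "y \<in> {y. 0 < y \<and> (\<forall>k. y / psum w (Suc k) \<in> I)}"
  hence C: "hardy_bound I M w C" and y: "0 < y" "\<And>k. y / psum w (Suc k) \<in> I"
    by auto
  let ?u = "\<lambda>n. psum w n / y * M (initial n (\<lambda>k. y / psum w (Suc k))) (initial n w)"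
  show "liminf (\<lambda>n. ereal (?u n)) \<le> C"
  proof (rule ccontr)
    assume "\<not> ?thesis"
    \<comment> \<open>Two reals \<open>D < c\<close> are inserted between \<open>C\<close> and the
      liminf: \<open>D\<close> acts as a real Hardy constant, \<open>c\<close> as an eventual lower
      bound of \<open>?u\<close>.\<close>
    then obtain D where D: "C < ereal D" "ereal D < liminf (\<lambda>n. ereal (?u n))"
      using ereal_dense2 by (auto simp: not_le)
    then obtain c where c: "D < c" "ereal c < liminf (\<lambda>n. ereal (?u n))"
      using ereal_dense2[OF D(2)] by auto
    have "hardy_bound I M w (ereal D)"
      using D(1) by (intro hardy_bound_mono[OF C] weight_seqs_nonneg[OF w]
        interval_Inf_zero_nonneg[OF I(2)]) auto
    moreover have "eventually (\<lambda>n. c < ?u n) sequentially"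
      using less_LiminfD[OF c(2)] by simp
    then obtain n0 where "\<And>n. n \<ge> n0 \<Longrightarrow> c \<le> ?u n"
      unfolding eventually_sequentially by (meson less_imp_le)
    ultimately have "c \<le> D"
      using hardy_bound_ge[OF I M w div _ y] by blast
    with c(1) show False by simp
  qed
qed

section \<open>Upper bound from the Kedlaya inequality and monotonicity\<close>

lemma kedlaya_partial_sum_le:
  assumes I: "is_interval I" "(INF x\<in>I. ereal x) = 0" "\<not> bdd_above I"
    and M: "monotone_mean R I M" "kedlaya_inequality I M w" and w: "w \<in> weight_seqs R"
    and x: "\<And>n. x n \<in> I" and y: "0 < y" "\<And>n. (\<Sum>i<n. w i * x i) \<le> y" and n: "0 < n"
  shows "(\<Sum>k<n. w k * M (initial (Suc k) x) (initial (Suc k) w))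
    \<le> psum w n * M (initial n (\<lambda>k. y / psum w (Suc k))) (initial n w)"
proof -
  note I_pos = unbounded_interval_Inf_zero_mem[OF I]
  define a where "a k = 1 / psum w (Suc k) * (\<Sum>i<Suc k. w i * x i)" for k
  have pos: "0 < psum w (Suc k)" for k
    by (rule psum_pos[OF w]) simp
  \<comment> \<open>All positive reals lie in \<open>I\<close>, so only a vanishing average needs
    care. Since \<open>w 0\<close> is positive, it forces \<open>x 0 = 0\<close>, and hence 0 is a
    point of \<open>I\<close>.\<close>
  have a_I: "a k \<in> I" for k
  proof (cases "a k = 0")
    case False
    have "0 \<le> a k"
      unfolding a_def using pos[of k] weight_seqs_nonneg[OF w] interval_Inf_zero_nonneg[OF I(2) x]
      by (intro mult_nonneg_nonneg sum_nonneg) (auto simp: less_imp_le)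
    with False show ?thesis by (intro I_pos) auto
  next
    case True
    have "w 0 * x 0 \<le> (\<Sum>i<Suc k. w i * x i)"
      using weight_seqs_nonneg[OF w] interval_Inf_zero_nonneg[OF I(2) x]
      by (intro member_le_sum) auto
    also have "(\<Sum>i<Suc k. w i * x i) = 0"
      using True pos[of k] unfolding a_def by (simp del: sum.lessThan_Suc)
    finally have "x 0 \<le> 0"
      using w by (auto simp: weight_seqs_def mult_le_0_iff)
    with interval_Inf_zero_nonneg[OF I(2) x] have "x 0 = 0"
      by (intro antisym)
    with x[of 0] True show ?thesis by simp
  qed
  have "1 / psum w n * (\<Sum>k<n. w k * M (initial (Suc k) x) (initial (Suc k) w))
      \<le> M (initial n a) (initial n w)"
    using M(2) n x unfolding kedlaya_inequality_def a_def by (auto simp: Suc_le_eq)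
  also have "\<dots> \<le> M (initial n (\<lambda>k. y / psum w (Suc k))) (initial n w)"
  proof (rule monotone_mean_le[OF M(1) w n a_I])
    show "y / psum w (Suc i) \<in> I" for i
      using y(1) pos by (intro I_pos) auto
    show "a i \<le> y / psum w (Suc i)" for i
      unfolding a_def using y(2)[of "Suc i"] pos[of i]
      by (simp add: divide_right_mono del: sum.lessThan_Suc)
  qed
  finally show ?thesis
    using psum_pos[OF w n] by (simp add: field_simps)
qed

lemma kedlaya_sum_null:
  assumes I: "(INF x\<in>I. ereal x) = 0"
    and M: "weighted_mean R I M" "kedlaya_inequality I M w" and w: "w \<in> weight_seqs R"
    and x: "\<And>n. x n \<in> I" and null: "\<And>n. w n * x n = 0"
  shows "(\<Sum>k<n. w k * M (initial (Suc k) x) (initial (Suc k) w)) \<le> 0"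
proof (cases "n = 0")
  case False
  hence n: "0 < n" by simp
  have "0 < w 0" using w by (simp add: weight_seqs_def)
  with null[of 0] x[of 0] have "0 \<in> I" by simp
  have "1 / psum w n * (\<Sum>k<n. w k * M (initial (Suc k) x) (initial (Suc k) w))
      \<le> M (initial n (\<lambda>k. 1 / psum w (Suc k) * (\<Sum>i<Suc k. w i * x i))) (initial n w)"
    using M(2) n x unfolding kedlaya_inequality_def by (auto simp: Suc_le_eq)
  also have "\<dots> = M (initial n (\<lambda>k. 0)) (initial n w)"
    by (simp only: null sum.neutral_const mult_zero_right)
  also have "\<dots> \<le> Max (set (initial n (\<lambda>k. 0)))"
    using \<open>0 \<in> I\<close> by (intro weighted_mean_le_Max[OF M(1) w n])
  also have "\<dots> = 0"
    using n by (auto simp: set_initial image_constant_conv)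
  finally show ?thesis
    using psum_pos[OF w n] by (simp add: field_simps)
qed simp

text \<open>\<open>C_constant I M w\<close> is itself an admissible constant: every partial sum
  \<open>P n\<close> is bounded by its product with \<open>s\<close>, separately for
  \<open>s\<close> infinite, zero, and positive real.\<close>

lemma hardy_constant_le_C_constant:
  assumes I: "is_interval I" "(INF x\<in>I. ereal x) = 0" "\<not> bdd_above I"
    and M: "weighted_mean R I M" "monotone_mean R I M" "kedlaya_inequality I M w"
    and w: "w \<in> weight_seqs R"
  shows "hardy_constant I M w \<le> C_constant I M w"
proof -
  note w0 = weight_seqs_nonneg[OF w]
  note I0 = interval_Inf_zero_nonneg[OF I(2)]
  have pos: "0 < psum w (Suc k)" for k
    by (rule psum_pos[OF w]) simp
  note I_pos = unbounded_interval_Inf_zero_mem[OF I]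
  define u where "u y n = psum w n / y * M (initial n (\<lambda>k. y / psum w (Suc k))) (initial n w)" for y n
  have liminf_le: "liminf (\<lambda>n. ereal (u y n)) \<le> C_constant I M w" if "0 < y" for y
    unfolding C_constant_def u_def using that pos I_pos
    by (intro SUP_upper) auto
  have "hardy_bound I M w (C_constant I M w)"
    unfolding hardy_bound_def
  proof (intro allI impI)
    fix x :: "nat \<Rightarrow> real" assume "range x \<subseteq> I"
    hence x: "x n \<in> I" for n by auto
    define P where "P n = (\<Sum>k<n. w k * M (initial (Suc k) x) (initial (Suc k) w))" for n
    have m_nonneg: "0 \<le> w n * M (initial (Suc n) x) (initial (Suc n) w)" for n
      by (intro mult_nonneg_nonneg w0 I0 weighted_mean_mem[OF M(1) w] x) auto
    have P_mono: "P m \<le> P n" if "m \<le> n" for m n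
      unfolding P_def using that m_nonneg by (intro sum_mono2) auto
    define s where "s = (\<Sum>n. ereal (w n * x n))"
    have s_ge: "ereal (\<Sum>i<n. w i * x i) \<le> s" for n
      using suminf_upper[of "\<lambda>n. ereal (w n * x n)" n] w0 I0 x by (simp add: s_def)
    have s_nonneg: "0 \<le> s"
      using s_ge[of 0] by (simp add: zero_ereal_def)
    have "ereal (P n) \<le> C_constant I M w * s" for n
    proof (cases s)
      case PInf
      \<comment> \<open>An infinite right-hand side only requires a positive constant. For
        \<open>y = 1\<close> the entries \<open>1 / psum w (Suc k)\<close> are nonincreasing, so the
        mean is at least the last one, \<open>1 / psum w n\<close>.\<close>
      have "1 \<le> u 1 n" if "0 < n" for n
      proof -
        have "1 / psum w n \<le> Min (set (initial n (\<lambda>k. 1 / psum w (Suc k))))"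
          using that pos psum_mono[OF w] psum_pos[OF w]
          by (intro Min.boundedI)
             (auto simp: set_initial Suc_le_eq intro!: divide_left_mono mult_pos_pos)
        also have "\<dots> \<le> M (initial n (\<lambda>k. 1 / psum w (Suc k))) (initial n w)"
          using that pos by (intro weighted_mean_ge_Min[OF M(1) w] I_pos) auto
        finally show ?thesis
          using psum_pos[OF w that] by (simp add: u_def field_simps)
      qed
      hence "1 \<le> liminf (\<lambda>n. ereal (u 1 n))"
        by (intro Liminf_bounded) (auto simp: eventually_sequentially intro!: exI[of _ 1])
      also have "\<dots> \<le> C_constant I M w"
        by (intro liminf_le) simp
      finally have "0 < C_constant I M w"
        by (rule less_le_trans[rotated]) simp
      with PInf show ?thesis by auto
    next
      case (real y)
      show ?thesis
      proof (cases "y = 0")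
        case True
        have "w n * x n = 0" for n
        proof -
          have "w n * x n \<le> (\<Sum>i<Suc n. w i * x i)"
            using w0 I0 x by (intro member_le_sum) auto
          also have "\<dots> \<le> 0"
            using s_ge[of "Suc n"] real True by (simp del: sum.lessThan_Suc)
          finally show ?thesis
            using w0[of n] I0[OF x[of n]] by (intro antisym mult_nonneg_nonneg)
        qed
        hence "P n \<le> 0"
          unfolding P_def by (intro kedlaya_sum_null[OF I(2) M(1,3) w x])
        with real True show ?thesis by (simp flip: zero_ereal_def)
      next
        case False
        hence y: "0 < y" using s_nonneg real by simp
        have y_ge: "(\<Sum>i<n. w i * x i) \<le> y" for n
          using s_ge[of n] real by simp
        \<comment> \<open>With \<open>n\<close> fixed, \<open>P n\<close> is bounded by
          \<open>P m\<close> for all larger \<open>m\<close>, so the estimate at \<open>m\<close>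
          passes to the liminf over \<open>m\<close>.\<close>
        have "ereal (P n / y) \<le> liminf (\<lambda>n. ereal (u y n))"
        proof (rule Liminf_bounded)
          have "P n / y \<le> u y m" if "m \<ge> Suc n" for m
          proof -
            have "P n \<le> P m" using that by (intro P_mono) auto
            also have "\<dots> \<le> psum w m * M (initial m (\<lambda>k. y / psum w (Suc k))) (initial m w)"
              unfolding P_def using that
              by (intro kedlaya_partial_sum_le[OF I M(2,3) w x y y_ge]) auto
            finally show ?thesis
              using y by (simp add: u_def field_simps)
          qed
          thus "\<forall>\<^sub>F m in sequentially. ereal (P n / y) \<le> ereal (u y m)"
            unfolding eventually_sequentially by (intro exI[of _ "Suc n"]) auto
        qed
        also have "\<dots> \<le> C_constant I M w"
          by (rule liminf_le[OF y])
        finally have "ereal (P n / y) * ereal y \<le> C_constant I M w * ereal y"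
          using y by (intro ereal_mult_right_mono) auto
        with y real show ?thesis by simp
      qed
    qed (use s_nonneg in auto)
    hence "(\<Sum>n. ereal (w n * M (initial (Suc n) x) (initial (Suc n) w))) \<le> C_constant I M w * s"
      using m_nonneg by (intro suminf_bound) (auto simp: P_def)
    thus "(\<Sum>n. ereal (w n * M (initial (Suc n) x) (initial (Suc n) w)))
        \<le> C_constant I M w * (\<Sum>n. ereal (w n * x n))"
      by (simp add: s_def)
  qed
  thus ?thesis
    unfolding hardy_constant_eq by (intro Inf_lower) auto
qed

text \<open>In the second part, \<open>y\<close> is the total weighted sum of an arbitrary sequence,
  and unboundedness of \<open>I\<close> ensures that the points \<open>y / psum w (Suc k)\<close>
  lie in \<open>I\<close>. The first part also admits bounded \<open>I\<close>, as it tests only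
  those \<open>y\<close> over which the supremum is taken.\<close>

theorem theorem4p1:
  fixes R I :: "real set"
    and M :: "real list \<Rightarrow> real list \<Rightarrow> real"
    and w :: "nat \<Rightarrow> real"
  assumes "real_ring R"
    and "is_interval I"
    and "(INF x\<in>I. ereal x) = 0"
    and "weighted_mean R I M"
    and "w \<in> weight_seqs R"
  shows "((\<Sum>n. ereal (w n)) = \<infinity> \<longrightarrow> hardy_constant I M w \<ge> C_constant I M w) \<and>
    (\<not> bdd_above I \<longrightarrow> monotone_mean R I M \<longrightarrow> kedlaya_inequality I M w \<longrightarrow>
      hardy_constant I M w \<le> C_constant I M w)"
  by (intro conjI impI C_constant_le_hardy_constant[OF assms(2-5)]
    hardy_constant_le_C_constant[OF assms(2,3) _ assms(4) _ _ assms(5)])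

end
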